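(* Let $C$ be a closed cone with nonempty interior $C^\circ$ in a finite dimensional real vector space $X$ and let $f\colon C^\circ\to C^\circ$ be a fixed point free mapping which is nonexpansive under Thompson's metric $d_C$. If $\mathcal{O}(x_0;f)$ has compact closure in the norm topology for some $x_0\in C^\circ$, then there exists a convex set $\Omega\subseteq\partial C$ such that for each $x\in C^\circ$ the accumulation points of $\mathcal{O}(x;f)$ lie in $\Omega$.
   Context: A cone $C\subseteq X$ is a convex set with $C\cap(-C)=\{0\}$ and $\lambda C\subseteq C$ for all $\lambda\ge 0$; $x\le_C y$ means $y-x\in C$. For $x,y\in C^\circ$ let $M(x/y)=\inf\{\beta\in\mathbb{R}\colon x\le_C\beta y\}$. Thompson's metric on $C^\circ$ is $d_C(x,y)=\log\max\{M(x/y),M(y/x)\}$. Nonexpansive means $d_C(f(x),f(y))\le d_C(x,y)$ for all $x,y\in C^\circ$. $\mathcal{O}(x;f)=\{f^k(x)\colon k\ge 0\}$; its accumulation points are the limits in the norm topology of $X$ of subsequences $(f^{k_i}(x))_i$ with $k_i\to\infty$. *)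

theory Defs
  imports "HOL-Analysis.Analysis"
begin

(* The library's cone only asks for closure under nonnegative scaling. *)
definition pointed_convex_cone :: "'a::real_vector set \<Rightarrow> bool"
  where "pointed_convex_cone C \<longleftrightarrow> convex C \<and> cone C \<and> C \<inter> uminus ` C = {0}"

definition cone_le :: "'a::real_vector set \<Rightarrow> 'a \<Rightarrow> 'a \<Rightarrow> bool"
  where "cone_le C x y \<longleftrightarrow> y - x \<in> C"

(* Meaningful for x, y in the interior of a closed pointed cone C: the set is then nonempty and bounded
   below, so that Inf is the true infimum, and the infimum is positive. *)
definition cone_M :: "'a::real_vector set \<Rightarrow> 'a \<Rightarrow> 'a \<Rightarrow> real"
  where "cone_M C x y = Inf {\<beta>::real. cone_le C x (\<beta> *\<^sub>R y)}"

definition thompson_metric :: "'a::real_vector set \<Rightarrow> 'a \<Rightarrow> 'a \<Rightarrow> real"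
  where "thompson_metric C x y = ln (max (cone_M C x y) (cone_M C y x))"

definition thompson_nonexpansive :: "'a::real_normed_vector set \<Rightarrow> ('a \<Rightarrow> 'a) \<Rightarrow> bool"
  where "thompson_nonexpansive C f \<longleftrightarrow>
    (\<forall>x\<in>interior C. \<forall>y\<in>interior C. thompson_metric C (f x) (f y) \<le> thompson_metric C x y)"

definition forward_orbit :: "('a \<Rightarrow> 'a) \<Rightarrow> 'a \<Rightarrow> 'a set"
  where "forward_orbit f x = {(f ^^ k) x | k :: nat. k \<ge> 0}"

(* Limits of subsequences of the iterates, not limit points of the orbit as a set:
   a point visited infinitely often by a periodic orbit counts. *)
definition orbit_accumulation_points :: "('a::topological_space \<Rightarrow> 'a) \<Rightarrow> 'a \<Rightarrow> 'a set"
  where "orbit_accumulation_points f x =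
    {y. \<exists>k :: nat \<Rightarrow> nat. strict_mono k \<and> (\<lambda>i. (f ^^ k i) x) \<longlonglongrightarrow> y}"

end

theory Submission
  imports Defs
begin

text \<open>Write \<open>x\<^sub>k\<close> for the orbit of a base point \<open>e\<close> and \<open>\<mu>\<^sub>k = M(e/x\<^sub>k)\<close> for its depth. The orbit is
  bounded in norm, so \<open>x\<^sub>k \<le> c e\<close> in the order of the cone, for some \<open>c\<close>.

  The depth is unbounded. Otherwise the orbit is bounded in Thompson's metric, whose balls are convex;
  the points within a fixed distance of all late \<open>x\<^sub>k\<close> form a convex invariant set with compact closure
  inside the interior, and Brouwer's theorem gives a fixed point
  (\<open>fixed_point_if_depth_bounded\<close>).

  The heart of the proof is that the convex hull of the accumulation points of \<open>x\<^sub>k\<close> then misses the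
  interior (\<open>convex_hull_accumulation_points_disjoint_interior\<close>). Suppose it does not. Then, for some
  \<open>\<delta> > 0\<close> and however late one starts, there are finitely many orbit points such that at each time \<open>k\<close>
  one of them, \<open>x\<^sub>n\<close>, satisfies \<open>M(x\<^sub>n/x\<^sub>k) > \<delta> \<mu>\<^sub>k\<close> (\<open>deep_relative_to_late_point\<close>). Take for \<open>k\<close> a time
  \<open>K\<close> at which the depth attains a large record \<open>\<tau>\<close>, and let \<open>p = K - n\<close>. The distance
  \<open>d(x\<^sub>m, x\<^bsub>m+p\<^esub>)\<close> does not increase with \<open>m\<close>, and \<open>M(x\<^bsub>m+p\<^esub>/x\<^sub>m) \<le> c \<mu>\<^sub>m\<close> is small
  compared with \<open>\<tau>\<close>; so for all \<open>m\<close> up to a prescribed bound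
  \<open>M(x\<^sub>m/x\<^bsub>m+p\<^esub>) > \<delta> \<tau>\<close>, while \<open>\<mu>\<^bsub>m+p\<^esub> \<le> \<tau>\<close> (\<open>almost_isometric_window\<close>).
  Choose such pairs \<open>(p\<^sub>s, \<tau>\<^sub>s)\<close> recursively, each window reaching beyond all earlier \<open>p\<^sub>r\<close> and each
  \<open>\<tau>\<^sub>s\<close> much larger than the earlier depths. By compactness \<open>x\<^bsub>p\<^sub>r\<^esub> \<le> x\<^bsub>p\<^sub>s\<^esub> + (\<delta>/2) e\<close> for some \<open>r < s\<close>.
  With \<open>m = p\<^sub>r\<close>, \<open>p = p\<^sub>s\<close> and \<open>\<tau> = \<tau>\<^sub>s\<close>, sublinearity of \<open>M\<close> in its first argument gives
  \<open>M(x\<^sub>m/x\<^bsub>m+p\<^esub>) \<le> M(x\<^sub>p/x\<^bsub>m+p\<^esub>) + (\<delta>/2) \<mu>\<^bsub>m+p\<^esub> \<le> max c \<mu>\<^sub>m + (\<delta>/2) \<tau> \<le> \<delta> \<tau>\<close>,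
  a contradiction.

  Any other orbit stays at bounded distance from \<open>x\<^sub>k\<close>, so each of its accumulation points is dominated
  by a multiple of one of those of \<open>x\<^sub>k\<close>. Hence \<open>\<Omega>\<close> can be the set of all points of the cone dominated
  by a positive multiple of a point of that convex hull.\<close>

section \<open>Closed cones with nonempty interior\<close>

text \<open>A closed pointed convex cone with nonempty interior in a nonzero Euclidean space; the origin is
  therefore never an interior point.\<close>

locale solid_cone =
  fixes C :: "'a::euclidean_space set"
  assumes pointed_convex: "pointed_convex_cone C"
    and closed: "closed C"
    and solid: "interior C \<noteq> {}"
begin

abbreviation le (infix "\<preceq>" 50)
  where "x \<preceq> y \<equiv> cone_le C x y"

lemma zero_mem: "0 \<in> C"
  using pointed_convex by (auto simp: pointed_convex_cone_def)

lemma scale_mem: "x \<in> C \<Longrightarrow> 0 \<le> c \<Longrightarrow> c *\<^sub>R x \<in> C"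
  using pointed_convex by (auto simp: pointed_convex_cone_def cone_def)

lemma add_mem: "x \<in> C \<Longrightarrow> y \<in> C \<Longrightarrow> x + y \<in> C"
  using pointed_convex convex_cone[of C] by (auto simp: pointed_convex_cone_def)

lemma pointed: "x \<in> C \<Longrightarrow> - x \<in> C \<Longrightarrow> x = 0"
proof -
  assume "x \<in> C" "- x \<in> C"
  then have "x \<in> C \<inter> uminus ` C" by (auto simp: image_iff intro!: bexI[of _ "- x"])
  then show "x = 0" using pointed_convex unfolding pointed_convex_cone_def by blast
qed

lemma le_refl: "x \<preceq> x"
  by (simp add: cone_le_def zero_mem)

lemma le_trans: "x \<preceq> y \<Longrightarrow> y \<preceq> z \<Longrightarrow> x \<preceq> z"
  using add_mem[of "y - x" "z - y"] by (simp add: cone_le_def)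

lemma le_add: "x \<preceq> y \<Longrightarrow> x' \<preceq> y' \<Longrightarrow> x + x' \<preceq> y + y'"
  using add_mem[of "y - x" "y' - x'"] by (simp add: cone_le_def algebra_simps)

lemma le_scale: "x \<preceq> y \<Longrightarrow> 0 \<le> c \<Longrightarrow> c *\<^sub>R x \<preceq> c *\<^sub>R y"
  using scale_mem[of "y - x" c] by (simp add: cone_le_def algebra_simps)

lemma le_scale_mono: "x \<in> C \<Longrightarrow> a \<le> b \<Longrightarrow> a *\<^sub>R x \<preceq> b *\<^sub>R x"
  using scale_mem[of x "b - a"] by (simp add: cone_le_def algebra_simps)

lemma convex_lower_set: "convex {v. v \<preceq> b}"
proof (rule convexI)
  fix x y and u v :: real
  assume xy: "x \<in> {v. v \<preceq> b}" "y \<in> {v. v \<preceq> b}" and uv: "0 \<le> u" "0 \<le> v" "u + v = 1"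
  have "u *\<^sub>R x + v *\<^sub>R y \<preceq> u *\<^sub>R b + v *\<^sub>R b"
    using xy uv by (intro le_add le_scale) auto
  also have "u *\<^sub>R b + v *\<^sub>R b = b" using uv(3) by (metis scaleR_left.add scaleR_one)
  finally show "u *\<^sub>R x + v *\<^sub>R y \<in> {v. v \<preceq> b}" by simp
qed

lemma interior_mem: "x \<in> interior C \<Longrightarrow> x \<in> C"
  using interior_subset by auto

lemma interior_add: "x \<in> interior C \<Longrightarrow> y \<in> C \<Longrightarrow> x + y \<in> interior C"
proof -
  assume x: "x \<in> interior C" and y: "y \<in> C"
  have "(+) y ` interior C \<subseteq> interior C"
    using y by (intro interior_maximal open_translation open_interior)
      (auto intro: add_mem interior_mem)
  then show ?thesis using x by (auto simp: add.commute)
qed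

lemma interior_mono: "x \<in> interior C \<Longrightarrow> x \<preceq> y \<Longrightarrow> y \<in> interior C"
  using interior_add[of x "y - x"] by (simp add: cone_le_def)

lemma interior_scale: "x \<in> interior C \<Longrightarrow> 0 < c \<Longrightarrow> c *\<^sub>R x \<in> interior C"
proof -
  assume x: "x \<in> interior C" and c: "0 < c"
  have "(*\<^sub>R) c ` interior C \<subseteq> interior C"
    using c by (intro interior_maximal open_scaling open_interior)
      (auto intro: scale_mem interior_mem)
  then show ?thesis using x by auto
qed

lemma zero_notin_interior: "0 \<notin> interior C"
proof
  assume "0 \<in> interior C"
  then obtain r where r: "0 < r" "cball 0 r \<subseteq> C"
    unfolding mem_interior_cball by auto
  obtain b :: 'a where b: "b \<in> Basis" using nonempty_Basis by blast
  then have "r *\<^sub>R b \<in> cball 0 r" "- (r *\<^sub>R b) \<in> cball 0 r"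
    using r by auto
  then have "r *\<^sub>R b = 0" using r pointed by blast
  then show False using r b by auto
qed

text \<open>Interior points are order units, uniformly with respect to the norm. The hypothesis forces
  \<^term>\<open>\<eta>\<close> to be nonnegative.\<close>

lemma order_unit:
  assumes "e \<in> interior C"
  obtains r where "0 < r" "\<And>v \<eta>. norm v \<le> r * \<eta> \<Longrightarrow> v \<preceq> \<eta> *\<^sub>R e"
proof -
  obtain r where r: "0 < r" "cball e r \<subseteq> C"
    using assms unfolding mem_interior_cball by auto
  have "v \<preceq> \<eta> *\<^sub>R e" if v: "norm v \<le> r * \<eta>" for v \<eta>
  proof (cases "\<eta> = 0")
    case True
    then show ?thesis using v by (simp add: le_refl)
  next
    case False
    have "0 \<le> r * \<eta>" using v norm_ge_zero[of v] by linarith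
    then have \<eta>: "0 < \<eta>" using False r by (simp add: zero_le_mult_iff)
    have "e - (1 / \<eta>) *\<^sub>R v \<in> cball e r"
      using \<eta> v by (simp add: dist_norm field_simps)
    then have "\<eta> *\<^sub>R (e - (1 / \<eta>) *\<^sub>R v) \<in> C" using r \<eta> by (intro scale_mem) auto
    then show ?thesis using \<eta> by (simp add: cone_le_def algebra_simps)
  qed
  then show thesis using that r by blast
qed

text \<open>The cone is normal. The distance from \<^term>\<open>- v\<close> to the cone is bounded below on the
  compact set of unit vectors \<^term>\<open>v\<close> of the cone, because the cone is closed and pointed.\<close>

lemma normal:
  obtains \<kappa> where "0 < \<kappa>" "\<And>v w. v \<in> C \<Longrightarrow> v \<preceq> w \<Longrightarrow> \<kappa> * norm v \<le> norm w"
proof -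
  let ?A = "C \<inter> sphere 0 1"
  have comp: "compact ?A" using closed by (simp add: closed_Int_compact)
  have ne: "?A \<noteq> {}"
  proof -
    obtain x where x: "x \<in> interior C" using solid by auto
    then have "x \<noteq> 0" using zero_notin_interior by auto
    then have "(1 / norm x) *\<^sub>R x \<in> ?A" using x interior_mem scale_mem by auto
    then show ?thesis by auto
  qed
  have "continuous_on ?A (\<lambda>v. infdist (- v) C)" by (intro continuous_intros)
  from continuous_attains_inf[OF comp ne this]
  obtain u where u: "u \<in> ?A" "\<And>v. v \<in> ?A \<Longrightarrow> infdist (- u) C \<le> infdist (- v) C" by blast
  let ?\<kappa> = "infdist (- u) C"
  have "- u \<notin> C" using u(1) pointed[of u] by auto
  then have "?\<kappa> \<noteq> 0" using in_closed_iff_infdist_zero[OF closed] zero_mem by auto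
  then have "0 < ?\<kappa>" using infdist_nonneg[of "- u" C] by linarith
  moreover have "?\<kappa> * norm v \<le> norm w" if v: "v \<in> C" "v \<preceq> w" for v w
  proof (cases "v = 0")
    case False
    let ?c = "1 / norm v"
    have "?c *\<^sub>R v \<in> ?A" using False v scale_mem by auto
    then have "?\<kappa> \<le> infdist (- (?c *\<^sub>R v)) C" by (rule u(2))
    also have "\<dots> \<le> dist (- (?c *\<^sub>R v)) (?c *\<^sub>R (w - v))"
      using v by (intro infdist_le scale_mem) (auto simp: cone_le_def)
    also have "\<dots> = norm w / norm v"
      by (simp add: dist_norm algebra_simps)
    finally show ?thesis using False by (simp add: field_simps)
  qed simp
  ultimately show thesis using that by blast
qed

section \<open>The order form of Thompson's metric\<close>

lemma coeff_nonneg: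
  assumes "x \<in> C" "y \<in> interior C" "x \<preceq> \<beta> *\<^sub>R y"
  shows "0 \<le> \<beta>"
proof (rule ccontr)
  assume neg: "\<not> 0 \<le> \<beta>"
  have "\<beta> *\<^sub>R y \<in> C" using add_mem[OF assms(1), of "\<beta> *\<^sub>R y - x"] assms(3) by (simp add: cone_le_def)
  moreover have "- (\<beta> *\<^sub>R y) \<in> C" using scale_mem[of y "- \<beta>"] assms(2) interior_mem neg by auto
  ultimately have "\<beta> *\<^sub>R y = 0" by (rule pointed)
  then show False using neg assms(2) zero_notin_interior by auto
qed

text \<open>The infimum that defines \<^const>\<open>cone_M\<close> is attained.\<close>

lemma le_iff_cone_M:
  assumes x: "x \<in> C" and y: "y \<in> interior C"
  shows "x \<preceq> \<beta> *\<^sub>R y \<longleftrightarrow> cone_M C x y \<le> \<beta>"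
proof -
  let ?A = "{\<beta>. x \<preceq> \<beta> *\<^sub>R y}"
  obtain r where r: "0 < r" "\<And>v \<eta>. norm v \<le> r * \<eta> \<Longrightarrow> v \<preceq> \<eta> *\<^sub>R y"
    using order_unit[OF y] by blast
  have ne: "?A \<noteq> {}" using r(1) r(2)[of x "norm x / r"] by auto
  have bdd: "bdd_below ?A" using coeff_nonneg[OF x y] by (auto intro: bdd_belowI[of _ 0])
  have "?A = (\<lambda>\<beta>. \<beta> *\<^sub>R y - x) -` C" by (auto simp: cone_le_def)
  then have "closed ?A" using closed
    by (auto intro!: closed_vimage continuous_intros)
  from closed_contains_Inf[OF ne bdd this]
  have M: "x \<preceq> cone_M C x y *\<^sub>R y" by (simp add: cone_M_def)
  show ?thesis
  proof
    assume "x \<preceq> \<beta> *\<^sub>R y"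
    then show "cone_M C x y \<le> \<beta>" unfolding cone_M_def using bdd by (intro cInf_lower) auto
  next
    assume "cone_M C x y \<le> \<beta>"
    then show "x \<preceq> \<beta> *\<^sub>R y" using M le_trans le_scale_mono interior_mem[OF y] by blast
  qed
qed

lemma cone_M_pos:
  assumes "x \<in> interior C" "y \<in> interior C"
  shows "0 < cone_M C x y"
proof (rule ccontr)
  assume "\<not> 0 < cone_M C x y"
  then have "x \<preceq> 0 *\<^sub>R y" using le_iff_cone_M[of x y 0] assms interior_mem by auto
  then have "x = 0" using pointed[of x] assms interior_mem by (auto simp: cone_le_def)
  then show False using assms zero_notin_interior by auto
qed

text \<open>The only property of Thompson's metric that is used below.\<close>

lemma thompson_le_iff:
  assumes "x \<in> interior C" "y \<in> interior C" "0 < \<rho>"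
  shows "thompson_metric C x y \<le> ln \<rho> \<longleftrightarrow> x \<preceq> \<rho> *\<^sub>R y \<and> y \<preceq> \<rho> *\<^sub>R x"
proof -
  have "0 < max (cone_M C x y) (cone_M C y x)" using cone_M_pos[OF assms(1,2)] by auto
  then show ?thesis
    using assms by (simp add: thompson_metric_def le_iff_cone_M interior_mem)
qed

end


section \<open>Norm-bounded orbits of nonexpansive maps\<close>

text \<open>The orbit of the base point \<^term>\<open>e\<close> is bounded in norm; nonexpansiveness is stated in its
  order form.\<close>

locale nonexpansive_orbit = solid_cone C for C :: "'a::euclidean_space set" +
  fixes f :: "'a \<Rightarrow> 'a" and e :: 'a
  assumes maps: "x \<in> interior C \<Longrightarrow> f x \<in> interior C"
    and nonexpansive: "\<lbrakk>x \<in> interior C; y \<in> interior C; 0 < \<rho>; x \<preceq> \<rho> *\<^sub>R y; y \<preceq> \<rho> *\<^sub>R x\<rbrakk>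
      \<Longrightarrow> f x \<preceq> \<rho> *\<^sub>R f y"
    and base: "e \<in> interior C"
    and bounded_orbit: "bounded (range (\<lambda>k. (f ^^ k) e))"
begin

abbreviation orb :: "nat \<Rightarrow> 'a"
  where "orb k \<equiv> (f ^^ k) e"

text \<open>The depth of the orbit at time \<^term>\<open>k\<close>: the least \<^term>\<open>\<beta>\<close> with \<^term>\<open>e \<preceq> \<beta> *\<^sub>R orb k\<close>.\<close>

definition depth :: "nat \<Rightarrow> real"
  where "depth k = cone_M C e (orb k)"

lemma iterate_interior: "x \<in> interior C \<Longrightarrow> (f ^^ k) x \<in> interior C"
  by (induction k) (auto intro: maps)

lemma iterate_nonexpansive:
  assumes "x \<in> interior C" "y \<in> interior C" "0 < \<rho>" "x \<preceq> \<rho> *\<^sub>R y" "y \<preceq> \<rho> *\<^sub>R x"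
  shows "(f ^^ k) x \<preceq> \<rho> *\<^sub>R (f ^^ k) y \<and> (f ^^ k) y \<preceq> \<rho> *\<^sub>R (f ^^ k) x"
  by (induction k) (use assms in \<open>auto intro: nonexpansive iterate_interior\<close>)

lemma orb_interior: "orb k \<in> interior C"
  using base by (rule iterate_interior)

lemma orb_mem: "orb k \<in> C"
  using orb_interior by (rule interior_mem)

lemma funpow_orb: "(f ^^ k) (orb m) = orb (m + k)"
  by (metis add.commute comp_apply funpow_add)

lemma le_depth_iff: "e \<preceq> \<beta> *\<^sub>R orb k \<longleftrightarrow> depth k \<le> \<beta>"
  unfolding depth_def by (intro le_iff_cone_M interior_mem base orb_interior)

lemma depth_pos: "0 < depth k"
  unfolding depth_def by (intro cone_M_pos base orb_interior)

lemma orbit_upper_bound: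
  obtains c where "1 \<le> c" "\<And>k. orb k \<preceq> c *\<^sub>R e"
proof -
  obtain r where r: "0 < r" "\<And>v \<eta>. norm v \<le> r * \<eta> \<Longrightarrow> v \<preceq> \<eta> *\<^sub>R e"
    using order_unit[OF base] by blast
  obtain B where B: "\<And>k. norm (orb k) \<le> B"
    using bounded_orbit unfolding bounded_iff by auto
  let ?c = "max 1 (B / r)"
  have "orb k \<preceq> ?c *\<^sub>R e" for k
  proof (rule r(2))
    have "norm (orb k) \<le> r * (B / r)" using B r(1) by simp
    also have "\<dots> \<le> r * ?c" using r(1) by (intro mult_left_mono) auto
    finally show "norm (orb k) \<le> r * ?c" .
  qed
  then show thesis using that[of ?c] by auto
qed

subsection \<open>Orbits of bounded depth yield fixed points\<close>

text \<open>For \<^term>\<open>y\<close> near \<^term>\<open>x\<close> the Thompson distance is small by the order unit property, and then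
  \<^term>\<open>norm (f y - f x)\<close> is small by normality.\<close>

lemma continuous_on_interior: "continuous_on (interior C) f"
  unfolding continuous_on_def
proof
  fix x assume x: "x \<in> interior C"
  obtain r where r: "0 < r" "\<And>v \<eta>. norm v \<le> r * \<eta> \<Longrightarrow> v \<preceq> \<eta> *\<^sub>R x"
    using order_unit[OF x] by blast
  obtain \<kappa> where \<kappa>: "0 < \<kappa>" "\<And>v w. v \<in> C \<Longrightarrow> v \<preceq> w \<Longrightarrow> \<kappa> * norm v \<le> norm w"
    using normal by blast
  define t where "t y = 1 - norm (y - x) / r" for y
  define g where "g y = (1 / t y - t y) * norm (f x) / \<kappa> + (1 - t y) * norm (f x)" for y
  have t_lim: "(t \<longlongrightarrow> 1) (at x within interior C)"
  proof -
    have "(t \<longlongrightarrow> 1 - norm (x - x) / r) (at x within interior C)"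
      unfolding t_def using r(1) by (intro tendsto_intros) auto
    then show ?thesis by simp
  qed
  have "(g \<longlongrightarrow> (1 / 1 - 1) * norm (f x) / \<kappa> + (1 - 1) * norm (f x)) (at x within interior C)"
    unfolding g_def using \<kappa>(1) by (intro tendsto_intros t_lim) auto
  then have g_lim: "(g \<longlongrightarrow> 0) (at x within interior C)" by simp
  have "\<forall>\<^sub>F y in at x within interior C. 0 < t y"
    using t_lim by (rule order_tendstoD) simp
  moreover have "\<forall>\<^sub>F y in at x within interior C. y \<in> interior C"
    by (simp add: eventually_at_filter)
  ultimately have "\<forall>\<^sub>F y in at x within interior C. norm (f y - f x) \<le> g y"
  proof eventually_elim
    case (elim y)
    let ?t = "t y"
    have t1: "?t \<le> 1" using r(1) by (simp add: t_def)
    have small: "y - x \<preceq> (1 - ?t) *\<^sub>R x" "x - y \<preceq> (1 - ?t) *\<^sub>R x"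
      using r by (auto simp: t_def norm_minus_commute intro!: r(2))
    have "1 + (1 - ?t) \<le> 1 / ?t"
      using elim(1) zero_le_power2[of "1 - ?t"] by (simp add: field_simps power2_eq_square)
    then have "(1 + (1 - ?t)) *\<^sub>R x \<preceq> (1 / ?t) *\<^sub>R x" by (rule le_scale_mono[OF interior_mem[OF x]])
    moreover have "y \<preceq> (1 + (1 - ?t)) *\<^sub>R x"
      using le_add[OF le_refl[of x] small(1)] unfolding scaleR_left_distrib scaleR_one by simp
    ultimately have yx: "y \<preceq> (1 / ?t) *\<^sub>R x" by (metis le_trans)
    have "?t *\<^sub>R x \<preceq> y" using small(2) by (simp add: cone_le_def algebra_simps)
    from le_scale[OF this, of "1 / ?t"] have xy: "x \<preceq> (1 / ?t) *\<^sub>R y" using elim(1) by simp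
    have fyx: "f y \<preceq> (1 / ?t) *\<^sub>R f x" and "f x \<preceq> (1 / ?t) *\<^sub>R f y"
      using nonexpansive[OF elim(2) x _ yx xy] nonexpansive[OF x elim(2) _ xy yx] elim(1) by auto
    from le_scale[OF this(2), of ?t] have fxy: "?t *\<^sub>R f x \<preceq> f y" using elim(1) by simp
    have "\<kappa> * norm (f y - ?t *\<^sub>R f x) \<le> norm ((1 / ?t - ?t) *\<^sub>R f x)"
      using fxy fyx by (intro \<kappa>(2)) (auto simp: cone_le_def algebra_simps)
    also have "\<dots> = (1 / ?t - ?t) * norm (f x)"
      using \<open>1 + (1 - ?t) \<le> 1 / ?t\<close> t1 by simp
    finally have "norm (f y - ?t *\<^sub>R f x) \<le> (1 / ?t - ?t) * norm (f x) / \<kappa>"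
      using \<kappa>(1) by (simp add: field_simps)
    moreover have "norm ((1 - ?t) *\<^sub>R f x) = (1 - ?t) * norm (f x)" using t1 by simp
    moreover have "norm (f y - f x) \<le> norm (f y - ?t *\<^sub>R f x) + norm ((1 - ?t) *\<^sub>R f x)"
      using norm_triangle_ineq4[of "f y - ?t *\<^sub>R f x" "(1 - ?t) *\<^sub>R f x"]
      by (simp add: algebra_simps)
    ultimately show ?case unfolding g_def by linarith
  qed
  then have "((\<lambda>y. f y - f x) \<longlongrightarrow> 0) (at x within interior C)"
    by (rule Lim_null_comparison[OF _ g_lim])
  then show "(f \<longlongrightarrow> f x) (at x within interior C)" by (rule LIM_zero_cancel)
qed

text \<open>If the depth is bounded, the points within a fixed Thompson distance of all sufficiently late
  orbit points form a convex invariant set, and Brouwer's theorem applies to its closure.\<close>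

lemma fixed_point_if_depth_bounded:
  assumes "\<And>k. depth k \<le> R"
  shows "\<exists>z\<in>interior C. f z = z"
proof -
  obtain c where c: "1 \<le> c" "\<And>k. orb k \<preceq> c *\<^sub>R e" using orbit_upper_bound by blast
  define \<rho> where "\<rho> = max c R"
  have \<rho>: "1 \<le> \<rho>" using c by (simp add: \<rho>_def)
  have up: "orb k \<preceq> \<rho> *\<^sub>R e" for k
    using c(2)[of k] le_scale_mono[OF interior_mem[OF base], of c \<rho>] le_trans
    unfolding \<rho>_def by (metis max.cobounded1)
  have low: "e \<preceq> \<rho> *\<^sub>R orb k" for k
    unfolding le_depth_iff using assms[of k] by (simp add: \<rho>_def)
  define D where "D = {z. \<exists>N. \<forall>n\<ge>N. orb n \<preceq> \<rho> *\<^sub>R z \<and> z \<preceq> \<rho> *\<^sub>R orb n}"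
  define S where "S = {z. e \<preceq> (\<rho> * \<rho>) *\<^sub>R z \<and> z \<preceq> (\<rho> * \<rho>) *\<^sub>R e}"
  have DS: "D \<subseteq> S"
  proof
    fix z assume "z \<in> D"
    then obtain n where n: "orb n \<preceq> \<rho> *\<^sub>R z" "z \<preceq> \<rho> *\<^sub>R orb n" by (auto simp: D_def)
    have "\<rho> *\<^sub>R orb n \<preceq> \<rho> *\<^sub>R (\<rho> *\<^sub>R z)" "\<rho> *\<^sub>R orb n \<preceq> \<rho> *\<^sub>R (\<rho> *\<^sub>R e)"
      using le_scale[OF n(1), of \<rho>] le_scale[OF up[of n], of \<rho>] \<rho> by auto
    then show "z \<in> S" using low[of n] n(2) by (auto simp: S_def intro: le_trans)
  qed
  have SI: "S \<subseteq> interior C"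
  proof
    fix z assume "z \<in> S"
    then have "(\<rho> * \<rho>) *\<^sub>R z \<in> interior C" using base interior_mono by (auto simp: S_def)
    then show "z \<in> interior C"
      using interior_scale[of "(\<rho> * \<rho>) *\<^sub>R z" "1 / (\<rho> * \<rho>)"] \<rho> by simp
  qed
  have "S = (\<lambda>z. (\<rho> * \<rho>) *\<^sub>R z - e) -` C \<inter> (\<lambda>z. (\<rho> * \<rho>) *\<^sub>R e - z) -` C"
    by (auto simp: S_def cone_le_def)
  then have "closed S"
    using closed by (auto intro!: closed_Int closed_vimage continuous_intros)
  then have clS: "closure D \<subseteq> S" using DS by (rule closure_minimal[rotated])
  obtain \<kappa> where \<kappa>: "0 < \<kappa>" "\<And>v w. v \<in> C \<Longrightarrow> v \<preceq> w \<Longrightarrow> \<kappa> * norm v \<le> norm w"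
    using normal by blast
  have "norm z \<le> norm ((\<rho> * \<rho>) *\<^sub>R e) / \<kappa>" if "z \<in> S" for z
    using \<kappa>(2)[of z "(\<rho> * \<rho>) *\<^sub>R e"] that SI interior_mem \<kappa>(1)
    by (auto simp: S_def field_simps)
  then have "bounded S" unfolding bounded_iff by blast
  then have "compact (closure D)"
    using clS bounded_subset by (auto simp: compact_eq_bounded_closed)
  moreover have "convex D"
  proof (rule convexI)
    fix y z and u v :: real
    assume yz: "y \<in> D" "z \<in> D" and uv: "0 \<le> u" "0 \<le> v" "u + v = 1"
    obtain N where N: "\<And>n. n \<ge> N \<Longrightarrow> orb n \<preceq> \<rho> *\<^sub>R y \<and> y \<preceq> \<rho> *\<^sub>R orb n"
      using yz(1) by (auto simp: D_def)
    obtain N' where N': "\<And>n. n \<ge> N' \<Longrightarrow> orb n \<preceq> \<rho> *\<^sub>R z \<and> z \<preceq> \<rho> *\<^sub>R orb n"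
      using yz(2) by (auto simp: D_def)
    have "orb n \<preceq> \<rho> *\<^sub>R (u *\<^sub>R y + v *\<^sub>R z) \<and> u *\<^sub>R y + v *\<^sub>R z \<preceq> \<rho> *\<^sub>R orb n" if "n \<ge> max N N'" for n
    proof -
      have split: "u *\<^sub>R w + v *\<^sub>R w = w" for w :: 'a
        using uv(3) by (metis scaleR_left.add scaleR_one)
      have "u *\<^sub>R orb n + v *\<^sub>R orb n \<preceq> u *\<^sub>R (\<rho> *\<^sub>R y) + v *\<^sub>R (\<rho> *\<^sub>R z)"
        "u *\<^sub>R y + v *\<^sub>R z \<preceq> u *\<^sub>R (\<rho> *\<^sub>R orb n) + v *\<^sub>R (\<rho> *\<^sub>R orb n)"
        using N[of n] N'[of n] that uv by (auto simp del: scaleR_scaleR intro!: le_add le_scale)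
      then show ?thesis unfolding split by (simp add: algebra_simps)
    qed
    then show "u *\<^sub>R y + v *\<^sub>R z \<in> D" unfolding D_def by blast
  qed
  then have "convex (closure D)" by (rule convex_closure)
  moreover have "closure D \<noteq> {}" using up low by (auto simp: D_def)
  moreover have "continuous_on (closure D) f"
    using continuous_on_interior clS SI by (meson continuous_on_subset subset_trans)
  moreover have "f \<in> closure D \<rightarrow> closure D"
  proof -
    have "f z \<in> D" if z: "z \<in> D" for z
    proof -
      obtain N where N: "\<And>n. n \<ge> N \<Longrightarrow> orb n \<preceq> \<rho> *\<^sub>R z \<and> z \<preceq> \<rho> *\<^sub>R orb n"
        using z by (auto simp: D_def)
      have zI: "z \<in> interior C" using z DS SI by auto
      have "orb n \<preceq> \<rho> *\<^sub>R f z \<and> f z \<preceq> \<rho> *\<^sub>R orb n" if n: "n \<ge> Suc N" for n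
      proof -
        obtain k where k: "n = Suc k" "k \<ge> N" using n by (cases n) auto
        show ?thesis unfolding k(1)
          using N[OF k(2)] nonexpansive[OF orb_interior zI] nonexpansive[OF zI orb_interior] \<rho> by auto
      qed
      then show ?thesis unfolding D_def by blast
    qed
    then have "f ` D \<subseteq> closure D" using closure_subset by fastforce
    then have "f ` closure D \<subseteq> closure D"
      using \<open>continuous_on (closure D) f\<close> by (intro image_closure_subset) auto
    then show ?thesis by auto
  qed
  ultimately obtain z where "z \<in> closure D" "f z = z" by (rule brouwer)
  then show ?thesis using clS SI by auto
qed

subsection \<open>Accumulation points when the depth is unbounded\<close>

text \<open>The depth has arbitrarily late record times with arbitrarily large values.\<close>

lemma depth_record:
  assumes unbdd: "\<And>R. \<exists>k. R < depth k"
  obtains K where "L \<le> K" "B < depth K" "\<And>k. k \<le> K \<Longrightarrow> depth k \<le> depth K"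
proof -
  let ?B = "max B (Max (depth ` {..L}))"
  obtain k0 where k0: "?B < depth k0" using unbdd by blast
  obtain K where K: "K \<le> k0" "\<And>k. k \<le> k0 \<Longrightarrow> depth k \<le> depth K"
  proof -
    have "Max (depth ` {..k0}) \<in> depth ` {..k0}" by (intro Max_in) auto
    then obtain K where "K \<le> k0" "depth K = Max (depth ` {..k0})"
      by (metis (no_types, lifting) atMost_iff imageE)
    then show thesis using that by auto
  qed
  have rec: "?B < depth K" using k0 K(2)[of k0] by linarith
  moreover have "L \<le> K"
  proof (rule ccontr)
    assume "\<not> L \<le> K"
    then have "depth K \<le> Max (depth ` {..L})" by (intro Max_ge) auto
    also have "\<dots> \<le> ?B" by (rule max.cobounded2)
    finally show False using rec by simp
  qed
  ultimately show thesis using that[of K] K by auto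
qed

text \<open>The interior point \<^term>\<open>w\<close> lies above a positive multiple of \<^term>\<open>e\<close>, and it is a convex
  combination of finitely many accumulation points; replacing these by late orbit points close to
  them costs only half of that multiple. If every such orbit point were below a small enough
  multiple of \<^term>\<open>depth k *\<^sub>R orb k\<close>, then \<^term>\<open>e \<preceq> (depth k / 2) *\<^sub>R orb k\<close> would follow.\<close>

lemma deep_relative_to_late_point:
  assumes w: "w \<in> convex hull (orbit_accumulation_points f e)" "w \<in> interior C"
  obtains \<delta> where "0 < \<delta>"
    "\<And>N. \<exists>S. finite S \<and> S \<subseteq> {N..} \<and> (\<forall>k. \<exists>n\<in>S. \<not> orb n \<preceq> (\<delta> * depth k) *\<^sub>R orb k)"
proof -
  obtain r where r: "0 < r" "\<And>v \<eta>. norm v \<le> r * \<eta> \<Longrightarrow> v \<preceq> \<eta> *\<^sub>R e"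
    using order_unit[OF base] by blast
  obtain s where s: "0 < s" "\<And>v \<eta>. norm v \<le> s * \<eta> \<Longrightarrow> v \<preceq> \<eta> *\<^sub>R w"
    using order_unit[OF w(2)] by blast
  have "e \<noteq> 0" using base zero_notin_interior by auto
  define \<eta> where "\<eta> = s / norm e / 2"
  have \<eta>: "0 < \<eta>" using s \<open>e \<noteq> 0\<close> by (simp add: \<eta>_def)
  have ew: "(2 * \<eta>) *\<^sub>R e \<preceq> w"
    using s(2)[of "(2 * \<eta>) *\<^sub>R e" 1] s(1) \<open>e \<noteq> 0\<close> by (simp add: \<eta>_def)
  obtain T where T: "finite T" "T \<subseteq> orbit_accumulation_points f e" "w \<in> convex hull T"
    using w(1) unfolding caratheodory[of "orbit_accumulation_points f e"] by blast
  have "\<exists>S. finite S \<and> S \<subseteq> {N..} \<and> (\<forall>k. \<exists>n\<in>S. \<not> orb n \<preceq> (\<eta> / 2 * depth k) *\<^sub>R orb k)" for N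
  proof -
    have "\<exists>n\<ge>N. v - orb n \<preceq> \<eta> *\<^sub>R e" if v: "v \<in> T" for v
    proof -
      obtain k where k: "strict_mono k" "(\<lambda>i. orb (k i)) \<longlonglongrightarrow> v"
        using v T(2) by (auto simp: orbit_accumulation_points_def)
      have "0 < r * \<eta>" using r \<eta> by simp
      then obtain i0 where "\<And>i. i \<ge> i0 \<Longrightarrow> norm (orb (k i) - v) < r * \<eta>"
        using LIMSEQ_D[OF k(2)] by blast
      from this[of "max i0 N"] have "v - orb (k (max i0 N)) \<preceq> \<eta> *\<^sub>R e"
        by (intro r(2)) (simp add: norm_minus_commute)
      moreover have "N \<le> k (max i0 N)"
        using seq_suble[OF k(1), of "max i0 N"] by simp
      ultimately show ?thesis by blast
    qed
    then obtain n where n: "\<And>v. v \<in> T \<Longrightarrow> N \<le> n v \<and> v - orb (n v) \<preceq> \<eta> *\<^sub>R e" by metis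
    have "\<exists>m\<in>n ` T. \<not> orb m \<preceq> (\<eta> / 2 * depth k) *\<^sub>R orb k" for k
    proof (rule ccontr)
      let ?b = "\<eta> *\<^sub>R e + (\<eta> / 2 * depth k) *\<^sub>R orb k"
      assume "\<not> ?thesis"
      then have "(v - orb (n v)) + orb (n v) \<preceq> ?b" if "v \<in> T" for v
        using n[OF that] that by (intro le_add) auto
      \<comment> \<open>The points below \<open>?b\<close> form a convex set, so \<open>w\<close> is one of them.\<close>
      then have "T \<subseteq> {v. v \<preceq> ?b}" by auto
      moreover have "convex {v. v \<preceq> ?b}" by (rule convex_lower_set)
      ultimately have "w \<preceq> ?b" using T(3) hull_minimal[of T "{v. v \<preceq> ?b}" convex] by auto
      then have "(2 * \<eta>) *\<^sub>R e \<preceq> ?b" using ew le_trans by blast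
      then have "\<eta> *\<^sub>R e \<preceq> (\<eta> / 2 * depth k) *\<^sub>R orb k"
        unfolding mult_2 scaleR_left_distrib by (simp add: cone_le_def)
      from le_scale[OF this, of "1 / \<eta>"] \<eta> have "e \<preceq> (depth k / 2) *\<^sub>R orb k" by simp
      then show False using depth_pos[of k] by (simp add: le_depth_iff)
    qed
    moreover have "n ` T \<subseteq> {N..}" "finite (n ` T)" using n T(1) by auto
    ultimately show ?thesis by blast
  qed
  then show thesis using that[of "\<eta> / 2"] \<eta> by auto
qed

text \<open>For suitable time lags \<^term>\<open>p\<close> the displacement from \<^term>\<open>m\<close> to \<^term>\<open>m + p\<close> stays, for
  all \<^term>\<open>m\<close> up to \<^term>\<open>N\<close>, within the factor \<^term>\<open>\<delta>\<close> of a common bound \<^term>\<open>\<tau>\<close> for the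
  depths reached. The bound is the depth at a record time \<open>K = n + p\<close>, where \<open>n \<ge> N\<close> is one of the late
  times of the preceding lemma.\<close>

lemma almost_isometric_window:
  assumes unbdd: "\<And>R. \<exists>k. R < depth k"
    and w: "w \<in> convex hull (orbit_accumulation_points f e)" "w \<in> interior C"
  obtains \<delta> where "0 < \<delta>"
    "\<And>N B. \<exists>p \<tau>. B \<le> \<tau> \<and> (\<forall>m\<le>N. \<not> orb m \<preceq> (\<delta> * \<tau>) *\<^sub>R orb (m + p) \<and> depth (m + p) \<le> \<tau>)"
proof -
  obtain \<delta> where \<delta>: "0 < \<delta>"
    "\<And>N. \<exists>S. finite S \<and> S \<subseteq> {N..} \<and> (\<forall>k. \<exists>n\<in>S. \<not> orb n \<preceq> (\<delta> * depth k) *\<^sub>R orb k)"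
    using deep_relative_to_late_point[OF w] by blast
  obtain c where c: "1 \<le> c" "\<And>k. orb k \<preceq> c *\<^sub>R e" using orbit_upper_bound by blast
  have "\<exists>p \<tau>. B \<le> \<tau> \<and> (\<forall>m\<le>N. \<not> orb m \<preceq> (\<delta> * \<tau>) *\<^sub>R orb (m + p) \<and> depth (m + p) \<le> \<tau>)" for N B
  proof -
    obtain S where S: "finite S" "S \<subseteq> {N..}" "\<And>k. \<exists>n\<in>S. \<not> orb n \<preceq> (\<delta> * depth k) *\<^sub>R orb k"
      using \<delta>(2)[of N] by blast
    define Q where "Q = Max (depth ` {..N})"
    have Q: "depth k \<le> Q" if "k \<le> N" for k
      unfolding Q_def using that by (intro Max_ge) auto
    obtain K where SK: "Max (insert 0 S) \<le> K" and K: "max B (c * Q / \<delta>) < depth K"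
      "\<And>k. k \<le> K \<Longrightarrow> depth k \<le> depth K"
      using depth_record[OF unbdd] by blast
    have big: "c * Q \<le> \<delta> * depth K" using K(1) \<delta>(1) by (simp add: field_simps)
    obtain n where n: "n \<in> S" "\<not> orb n \<preceq> (\<delta> * depth K) *\<^sub>R orb K" using S(3) by blast
    have "n \<le> Max (insert 0 S)" using S(1) n(1) by (intro Max_ge) auto
    then have "n \<le> K" using SK by simp
    obtain p where p: "K = n + p" using \<open>n \<le> K\<close> le_Suc_ex by blast
    have "\<not> orb m \<preceq> (\<delta> * depth K) *\<^sub>R orb (m + p) \<and> depth (m + p) \<le> depth K" if m: "m \<le> N" for m
    proof
      have mn: "m \<le> n" using m n(1) S(2) by auto
      show "depth (m + p) \<le> depth K" using mn p K(2) by auto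
      show "\<not> orb m \<preceq> (\<delta> * depth K) *\<^sub>R orb (m + p)"
      proof
        \<comment> \<open>Both order relations would then hold between \<open>x\<^sub>m\<close> and \<open>x\<^bsub>m+p\<^esub>\<close>, and \<open>n - m\<close> further
          applications of \<open>f\<close> would carry them to \<open>x\<^sub>n\<close> and \<open>x\<^sub>K\<close>.\<close>
        assume le: "orb m \<preceq> (\<delta> * depth K) *\<^sub>R orb (m + p)"
        have "c *\<^sub>R e \<preceq> c *\<^sub>R (depth m *\<^sub>R orb m)"
          using c(1) by (intro le_scale) (auto simp: le_depth_iff)
        moreover have "(c * depth m) *\<^sub>R orb m \<preceq> (\<delta> * depth K) *\<^sub>R orb m"
        proof (rule le_scale_mono[OF orb_mem])
          have "c * depth m \<le> c * Q" using Q[of m] m c(1) by simp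
          then show "c * depth m \<le> \<delta> * depth K" using big by simp
        qed
        ultimately have "orb (m + p) \<preceq> (\<delta> * depth K) *\<^sub>R orb m"
          using le_trans[OF c(2)[of "m + p"]] le_trans unfolding scaleR_scaleR by blast
        moreover have "0 < \<delta> * depth K" using \<delta>(1) depth_pos by simp
        ultimately have "(f ^^ (n - m)) (orb m) \<preceq> (\<delta> * depth K) *\<^sub>R (f ^^ (n - m)) (orb (m + p))"
          using iterate_nonexpansive[OF orb_interior orb_interior _ le] by blast
        then show False using n(2) mn by (simp add: funpow_orb p add.commute)
      qed
    qed
    moreover have "B \<le> depth K" using K(1) by simp
    ultimately show ?thesis by blast
  qed
  then show thesis using that \<delta>(1) by blast
qed

lemma convex_hull_accumulation_points_disjoint_interior:
  assumes unbdd: "\<And>R. \<exists>k. R < depth k"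
  shows "convex hull (orbit_accumulation_points f e) \<inter> interior C = {}"
proof (rule ccontr)
  assume "\<not> ?thesis"
  then obtain w where w: "w \<in> convex hull (orbit_accumulation_points f e)" "w \<in> interior C" by auto
  obtain \<delta> where \<delta>: "0 < \<delta>"
    "\<And>N B. \<exists>p \<tau>. B \<le> \<tau> \<and> (\<forall>m\<le>N. \<not> orb m \<preceq> (\<delta> * \<tau>) *\<^sub>R orb (m + p) \<and> depth (m + p) \<le> \<tau>)"
    using almost_isometric_window[OF unbdd w] by blast
  obtain c where c: "1 \<le> c" "\<And>k. orb k \<preceq> c *\<^sub>R e" using orbit_upper_bound by blast
  obtain r where r: "0 < r" "\<And>v \<eta>. norm v \<le> r * \<eta> \<Longrightarrow> v \<preceq> \<eta> *\<^sub>R e"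
    using order_unit[OF base] by blast
  define R where "R N = max c (Max (depth ` {..N}))" for N
  obtain P \<tau> where P: "\<And>N. 2 / \<delta> * R N \<le> \<tau> N"
    "\<And>N m. m \<le> N \<Longrightarrow> \<not> orb m \<preceq> (\<delta> * \<tau> N) *\<^sub>R orb (m + P N) \<and> depth (m + P N) \<le> \<tau> N"
    using \<delta>(2)[of "2 / \<delta> * R N" N for N] by metis
  \<comment> \<open>The windows \<open>M s\<close> grow so that each contains all lags \<open>P (M r)\<close> with \<open>r < s\<close>.\<close>
  define M where "M = rec_nat 0 (\<lambda>_ N. N + P N)"
  have M: "M (Suc s) = M s + P (M s)" for s by (simp add: M_def)
  have "mono M" by (simp add: mono_iff_le_Suc M)
  have "bounded (range (\<lambda>s. orb (P (M s))))"
    using bounded_orbit by (rule bounded_subset) auto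
  from bounded_imp_convergent_subsequence[OF this]
  obtain l q where q: "strict_mono q" "((\<lambda>s. orb (P (M s))) \<circ> q) \<longlonglongrightarrow> l" by blast
  then have "Cauchy ((\<lambda>s. orb (P (M s))) \<circ> q)" using LIMSEQ_imp_Cauchy by blast
  then obtain i where "\<And>j k. j \<ge> i \<Longrightarrow> k \<ge> i \<Longrightarrow> norm (orb (P (M (q j))) - orb (P (M (q k)))) < r * (\<delta> / 2)"
    using CauchyD[of _ "r * (\<delta> / 2)"] r(1) \<delta>(1) by fastforce
  from this[of i "Suc i"] obtain s t where st: "s < t" "norm (orb (P (M s)) - orb (P (M t))) < r * (\<delta> / 2)"
    using q(1) by (auto simp: strict_mono_Suc_iff)
  define m p \<theta> \<sigma> where "m = P (M s)" "p = P (M t)" "\<theta> = \<tau> (M t)" "\<sigma> = R (M t)"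
  note defs = this
  have "m \<le> M (Suc s)" by (simp add: M defs)
  also have "\<dots> \<le> M t" using \<open>mono M\<close> st(1) by (auto intro: monoD)
  finally have m: "m \<le> M t" .
  have \<sigma>: "1 \<le> \<sigma>" "c \<le> \<sigma>" "depth m \<le> \<sigma>" "\<sigma> \<le> \<delta> / 2 * \<theta>"
  proof -
    show "c \<le> \<sigma>" by (simp add: defs R_def)
    then show "1 \<le> \<sigma>" using c(1) by simp
    have "depth m \<le> Max (depth ` {..M t})" using m by (intro Max_ge) auto
    then show "depth m \<le> \<sigma>" by (simp add: defs(4) R_def)
    show "\<sigma> \<le> \<delta> / 2 * \<theta>" using P(1)[of "M t"] \<delta>(1) by (simp add: defs field_simps)
  qed
  \<comment> \<open>Nonexpansiveness, over time \<open>p\<close>, applied to the points \<open>e\<close> and \<open>x\<^sub>m\<close>.\<close>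
  have "e \<preceq> \<sigma> *\<^sub>R orb m" using \<sigma> by (simp add: le_depth_iff)
  moreover have "orb m \<preceq> \<sigma> *\<^sub>R e"
    using c(2) le_scale_mono[OF interior_mem[OF base] \<sigma>(2)] le_trans by blast
  ultimately have "(f ^^ p) e \<preceq> \<sigma> *\<^sub>R (f ^^ p) (orb m)"
    using iterate_nonexpansive[OF base orb_interior] \<sigma>(1) by auto
  moreover have "\<sigma> *\<^sub>R orb (m + p) \<preceq> (\<delta> / 2 * \<theta>) *\<^sub>R orb (m + p)"
    using \<sigma>(4) by (rule le_scale_mono[OF orb_mem])
  ultimately have 1: "orb p \<preceq> (\<delta> / 2 * \<theta>) *\<^sub>R orb (m + p)"
    unfolding funpow_orb using le_trans by blast
  have "depth (m + p) \<le> \<theta>" using P(2)[OF m] by (simp add: defs)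
  then have "e \<preceq> \<theta> *\<^sub>R orb (m + p)" by (simp add: le_depth_iff)
  then have "(\<delta> / 2) *\<^sub>R e \<preceq> (\<delta> / 2) *\<^sub>R (\<theta> *\<^sub>R orb (m + p))" using \<delta>(1) by (intro le_scale) auto
  moreover have "orb m - orb p \<preceq> (\<delta> / 2) *\<^sub>R e" using st(2) by (intro r(2)) (simp add: defs)
  ultimately have "orb m - orb p \<preceq> (\<delta> / 2 * \<theta>) *\<^sub>R orb (m + p)" using le_trans by fastforce
  from le_add[OF this 1] have "orb m \<preceq> (\<delta> * \<theta>) *\<^sub>R orb (m + p)"
    by (simp flip: scaleR_add_left)
  then show False using P(2)[OF m] by (simp add: defs)
qed

text \<open>Every orbit stays within a bounded Thompson distance of the orbit of \<^term>\<open>e\<close>.\<close>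

lemma accumulation_point_dominated:
  assumes x: "x \<in> interior C" and y: "y \<in> orbit_accumulation_points f x"
  obtains \<rho> z where "0 < \<rho>" "z \<in> orbit_accumulation_points f e" "y \<preceq> \<rho> *\<^sub>R z"
proof -
  obtain k where k: "strict_mono k" "(\<lambda>i. (f ^^ k i) x) \<longlonglongrightarrow> y"
    using y by (auto simp: orbit_accumulation_points_def)
  have "bounded (range (\<lambda>i. orb (k i)))" using bounded_orbit by (rule bounded_subset) auto
  from bounded_imp_convergent_subsequence[OF this]
  obtain z q where q: "strict_mono q" "((\<lambda>i. orb (k i)) \<circ> q) \<longlonglongrightarrow> z" by blast
  have "z \<in> orbit_accumulation_points f e"
    unfolding orbit_accumulation_points_def using q strict_mono_o[OF k(1) q(1)]
    by (auto simp: o_def intro!: exI[of _ "k \<circ> q"])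
  define \<rho> where "\<rho> = max (cone_M C x e) (cone_M C e x)"
  have \<rho>: "0 < \<rho>" "x \<preceq> \<rho> *\<^sub>R e" "e \<preceq> \<rho> *\<^sub>R x"
    using cone_M_pos[OF x base] x base interior_mem le_iff_cone_M
    by (auto simp: \<rho>_def less_max_iff_disj)
  have "\<rho> *\<^sub>R orb (k (q i)) - (f ^^ k (q i)) x \<in> C" for i
    using iterate_nonexpansive[OF x base \<rho>] by (simp add: cone_le_def)
  moreover have "(\<lambda>i. \<rho> *\<^sub>R orb (k (q i)) - (f ^^ k (q i)) x) \<longlonglongrightarrow> \<rho> *\<^sub>R z - y"
    using q(2) LIMSEQ_subseq_LIMSEQ[OF k(2) q(1)] by (auto simp: o_def intro!: tendsto_intros)
  ultimately have "y \<preceq> \<rho> *\<^sub>R z"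
    unfolding cone_le_def by (rule closed_sequentially[OF closed])
  with \<rho>(1) \<open>z \<in> _\<close> show thesis using that by blast
qed

end

section \<open>A convex set in the boundary attracting all orbits\<close>

theorem theorem1p3:
  fixes C :: "'a::euclidean_space set" and f :: "'a \<Rightarrow> 'a"
  assumes "pointed_convex_cone C" and "closed C" and "interior C \<noteq> {}"
    and "f \<in> interior C \<rightarrow> interior C"
    and "\<forall>x\<in>interior C. f x \<noteq> x"
    and "thompson_nonexpansive C f"
    and "\<exists>x0\<in>interior C. compact (closure (forward_orbit f x0))"
  shows "\<exists>\<Omega>. convex \<Omega> \<and> \<Omega> \<subseteq> frontier C \<and>
    (\<forall>x\<in>interior C. orbit_accumulation_points f x \<subseteq> \<Omega>)"
proof -
  obtain e where e: "e \<in> interior C" "compact (closure (forward_orbit f e))"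
    using assms(7) by blast
  interpret solid_cone C by unfold_locales (use assms in auto)
  interpret nonexpansive_orbit C f e
  proof
    show maps: "f x \<in> interior C" if "x \<in> interior C" for x
      using assms(4) that by auto
    show "f x \<preceq> \<rho> *\<^sub>R f y"
      if "x \<in> interior C" "y \<in> interior C" "0 < \<rho>" "x \<preceq> \<rho> *\<^sub>R y" "y \<preceq> \<rho> *\<^sub>R x" for x y \<rho>
    proof -
      have "thompson_metric C (f x) (f y) \<le> thompson_metric C x y"
        using assms(6) that by (simp add: thompson_nonexpansive_def)
      then have "thompson_metric C (f x) (f y) \<le> ln \<rho>"
        using that thompson_le_iff[of x y \<rho>] by simp
      then show ?thesis using that maps thompson_le_iff[of "f x" "f y" \<rho>] by simp
    qed
    have "range (\<lambda>k. (f ^^ k) e) \<subseteq> closure (forward_orbit f e)"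
      using closure_subset[of "forward_orbit f e"] by (auto simp: forward_orbit_def)
    then show "bounded (range (\<lambda>k. (f ^^ k) e))"
      using e(2) compact_imp_bounded bounded_subset by blast
  qed (rule e(1))
  let ?H = "convex hull (orbit_accumulation_points f e)"
  have "\<exists>k. R < depth k" for R
    using fixed_point_if_depth_bounded[of R] assms(5) by (metis not_le_imp_less)
  then have disj: "?H \<inter> interior C = {}"
    by (rule convex_hull_accumulation_points_disjoint_interior)
  define \<Omega> where "\<Omega> = {y \<in> C. \<exists>\<rho> z. 0 < \<rho> \<and> z \<in> ?H \<and> y \<preceq> \<rho> *\<^sub>R z}"
  have "convex \<Omega>"
  proof (rule convexI)
    fix y y' and u v :: real
    assume y: "y \<in> \<Omega>" "y' \<in> \<Omega>" and uv: "0 \<le> u" "0 \<le> v" "u + v = 1"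
    obtain \<rho> z where z: "0 < \<rho>" "z \<in> ?H" "y \<preceq> \<rho> *\<^sub>R z" using y(1) by (auto simp: \<Omega>_def)
    obtain \<rho>' z' where z': "0 < \<rho>'" "z' \<in> ?H" "y' \<preceq> \<rho>' *\<^sub>R z'" using y(2) by (auto simp: \<Omega>_def)
    define \<sigma> where "\<sigma> = u * \<rho> + v * \<rho>'"
    have \<sigma>: "0 < \<sigma>"
      using z(1) z'(1) uv unfolding \<sigma>_def
      by (cases "u = 0") (auto intro: add_pos_nonneg)
    have "u *\<^sub>R y + v *\<^sub>R y' \<preceq> u *\<^sub>R (\<rho> *\<^sub>R z) + v *\<^sub>R (\<rho>' *\<^sub>R z')"
      using z(3) z'(3) uv by (intro le_add le_scale)
    also have "\<dots> = \<sigma> *\<^sub>R ((u * \<rho> / \<sigma>) *\<^sub>R z + (v * \<rho>' / \<sigma>) *\<^sub>R z')"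
      using \<sigma> by (simp add: scaleR_add_right)
    finally have "u *\<^sub>R y + v *\<^sub>R y' \<preceq> \<dots>" .
    moreover have "(u * \<rho> / \<sigma>) *\<^sub>R z + (v * \<rho>' / \<sigma>) *\<^sub>R z' \<in> ?H"
      using z z' uv \<sigma> by (intro convexD[OF convex_convex_hull])
        (auto simp: \<sigma>_def simp flip: add_divide_distrib)
    moreover have "u *\<^sub>R y + v *\<^sub>R y' \<in> C"
      using y uv by (auto simp: \<Omega>_def intro: add_mem scale_mem)
    ultimately show "u *\<^sub>R y + v *\<^sub>R y' \<in> \<Omega>" using \<sigma> unfolding \<Omega>_def by blast
  qed
  moreover have "\<Omega> \<subseteq> frontier C"
  proof
    fix y assume y: "y \<in> \<Omega>"
    then obtain \<rho> z where z: "0 < \<rho>" "z \<in> ?H" "y \<preceq> \<rho> *\<^sub>R z" by (auto simp: \<Omega>_def)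
    have "y \<notin> interior C"
    proof
      assume "y \<in> interior C"
      then have "\<rho> *\<^sub>R z \<in> interior C" using z(3) interior_mono by blast
      then have "z \<in> interior C" using interior_scale[of "\<rho> *\<^sub>R z" "1 / \<rho>"] z(1) by simp
      then show False using disj z(2) by blast
    qed
    then show "y \<in> frontier C" using y closed by (simp add: frontier_def \<Omega>_def)
  qed
  moreover have "orbit_accumulation_points f x \<subseteq> \<Omega>" if x: "x \<in> interior C" for x
  proof
    fix y assume y: "y \<in> orbit_accumulation_points f x"
    have "y \<in> C"
    proof -
      obtain k where k: "(\<lambda>i. (f ^^ k i) x) \<longlonglongrightarrow> y"
        using y by (auto simp: orbit_accumulation_points_def)
      have "(f ^^ k i) x \<in> C" for i using x iterate_interior interior_mem by blast
      then show ?thesis using k by (rule closed_sequentially[OF closed])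
    qed
    moreover obtain \<rho> z where "0 < \<rho>" "z \<in> orbit_accumulation_points f e" "y \<preceq> \<rho> *\<^sub>R z"
      using accumulation_point_dominated[OF x y] by blast
    ultimately show "y \<in> \<Omega>" unfolding \<Omega>_def using hull_inc[of z] by blast
  qed
  ultimately show ?thesis by blast
qed

end
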